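(* The randomized competitive ratio (against an oblivious adversary) of the metrical task system problem on the metric space of $n$ equally spaced points on the line is $O(\log^2 n)$: there is a constant $C$ such that for every $n\ge2$ there is a randomized online algorithm for the metrical task system on $\{1,2,\ldots,n\}$ with metric $d(i,j)=|i-j|$ that is $C\log^2 n$-competitive.
   Context: A metrical task system on a finite metric space $(M,d)$: an online algorithm occupies a state in $M$; tasks are arbitrary vectors $(c_u)_{u\in M}$ of non-negative reals; on each task the algorithm may move from its state $u$ to a state $v$ and pays $d(u,v)+c_v$, deciding based only on past tasks. $\mathrm{cost}_{OPT}(\sigma)$ is the minimum cost of an offline player serving $\sigma$ from the same initial state. A randomized online algorithm $A$ is $r$-competitive against an oblivious adversary if there is $c$ with $E[\mathrm{cost}_A(\sigma)]\le r\,\mathrm{cost}_{OPT}(\sigma)+c$ for all task sequences $\sigma$. *)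

theory Defs
  imports "HOL-Probability.Probability"
begin

text \<open>
  A metrical task system is given by a finite set \<open>M\<close> of states and a metric \<open>d\<close> on \<open>M\<close>.
  Task vectors are extensional functions on \<open>M\<close>, so that a task carries no information
  besides its costs at the states.
\<close>

definition tasks :: "'a set \<Rightarrow> ('a \<Rightarrow> real) set" where
  "tasks M = M \<rightarrow>\<^sub>E {0..}"

text \<open>
  The cost of serving the tasks \<open>\<sigma> = [\<sigma>\<^sub>0, \<sigma>\<^sub>1, \<dots>]\<close> from the initial state \<open>s\<close>, where \<open>xs ! i\<close>
  is the state in which \<open>\<sigma> ! i\<close> is served. Only used for \<open>length xs = length \<sigma>\<close>.
\<close>

definition schedule_cost ::
    "('a \<Rightarrow> 'a \<Rightarrow> real) \<Rightarrow> 'a \<Rightarrow> ('a \<Rightarrow> real) list \<Rightarrow> 'a list \<Rightarrow> real" where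
  "schedule_cost d s \<sigma> xs =
     (\<Sum>i<length \<sigma>. d ((s # xs) ! i) (xs ! i) + (\<sigma> ! i) (xs ! i))"

definition opt_cost ::
    "'a set \<Rightarrow> ('a \<Rightarrow> 'a \<Rightarrow> real) \<Rightarrow> 'a \<Rightarrow> ('a \<Rightarrow> real) list \<Rightarrow> real" where
  "opt_cost M d s \<sigma> =
     Min (schedule_cost d s \<sigma> ` {xs. set xs \<subseteq> M \<and> length xs = length \<sigma>})"

text \<open>
  A deterministic online algorithm maps the nonempty list of tasks presented so far (the
  current task being the last entry) to the state in which the current task is served.
  A dependence on its own earlier states would be redundant, since these are determined by
  the earlier tasks.
\<close>

definition histories :: "'a set \<Rightarrow> ('a \<Rightarrow> real) list set" where
  "histories M = lists (tasks M) - {[]}"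

definition online_schedule ::
    "(('a \<Rightarrow> real) list \<Rightarrow> 'a) \<Rightarrow> ('a \<Rightarrow> real) list \<Rightarrow> 'a list" where
  "online_schedule A \<sigma> = map (\<lambda>i. A (take (Suc i) \<sigma>)) [0..<length \<sigma>]"

text \<open>
  A randomized online algorithm is a probability distribution on the set of deterministic
  ones. The product sigma-algebra is the smallest one for which the state chosen after each
  history is a random variable.
\<close>

definition randomized_algorithm ::
    "'a set \<Rightarrow> (('a \<Rightarrow> real) list \<Rightarrow> 'a) measure \<Rightarrow> bool" where
  "randomized_algorithm M P \<longleftrightarrow>
     prob_space P \<and> sets P = sets (Pi\<^sub>M (histories M) (\<lambda>_. count_space M))"

definition expected_cost ::
    "('a \<Rightarrow> 'a \<Rightarrow> real) \<Rightarrow> 'a \<Rightarrow> (('a \<Rightarrow> real) list \<Rightarrow> 'a) measure \<Rightarrow> ('a \<Rightarrow> real) list \<Rightarrow> real"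
  where
  "expected_cost d s P \<sigma> = (\<integral>A. schedule_cost d s \<sigma> (online_schedule A \<sigma>) \<partial>P)"

text \<open>
  The adversary is oblivious: \<open>\<sigma>\<close> is fixed before the algorithm's random choice is made.
  The additive constant may depend on everything but \<open>\<sigma>\<close>.
\<close>

definition competitive ::
    "'a set \<Rightarrow> ('a \<Rightarrow> 'a \<Rightarrow> real) \<Rightarrow> 'a \<Rightarrow> (('a \<Rightarrow> real) list \<Rightarrow> 'a) measure \<Rightarrow> real \<Rightarrow> bool" where
  "competitive M d s P r \<longleftrightarrow>
     (\<exists>c. \<forall>\<sigma>\<in>lists (tasks M). expected_cost d s P \<sigma> \<le> r * opt_cost M d s \<sigma> + c)"

definition line_dist :: "nat \<Rightarrow> nat \<Rightarrow> real" where
  "line_dist i j = \<bar>real i - real j\<bar>"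

lemma Metric_space_line: "Metric_space {1..n} line_dist"
  by unfold_locales (auto simp: line_dist_def)

text \<open>
  The Bochner integral in \<open>expected_cost\<close> is always that of an integrable function.
\<close>

lemma integrable_schedule_cost:
  fixes d :: "'a \<Rightarrow> 'a \<Rightarrow> real"
  assumes M: "finite M" and s: "s \<in> M" and P: "randomized_algorithm M P"
    and \<sigma>: "\<sigma> \<in> lists (tasks M)"
  shows "integrable P (\<lambda>A. schedule_cost d s \<sigma> (online_schedule A \<sigma>))"
proof -
  interpret prob_space P
    using P by (simp add: randomized_algorithm_def)
  have sP: "sets P = sets (Pi\<^sub>M (histories M) (\<lambda>_. count_space M))"
    using P by (simp add: randomized_algorithm_def)
  define X where "X i A = (s # online_schedule A \<sigma>) ! i" for i A
  have XS: "X (Suc i) A = A (take (Suc i) \<sigma>)" if "i < length \<sigma>" for i A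
    using that by (simp add: X_def online_schedule_def)
  have X: "X i \<in> P \<rightarrow>\<^sub>M count_space M" if "i \<le> length \<sigma>" for i
  proof (cases i)
    case 0
    then have "X i = (\<lambda>A. s)" by (simp add: X_def fun_eq_iff)
    then show ?thesis using s by simp
  next
    case (Suc j)
    have "take (Suc j) \<sigma> \<in> histories M"
      using \<sigma> that Suc by (auto simp: histories_def dest: in_set_takeD)
    then have "(\<lambda>A. A (take (Suc j) \<sigma>)) \<in> P \<rightarrow>\<^sub>M count_space M"
      unfolding measurable_cong_sets[OF sP refl] by (rule measurable_component_singleton)
    moreover have "X i = (\<lambda>A. A (take (Suc j) \<sigma>))"
      using XS that Suc by fastforce
    ultimately show ?thesis by simp
  qed
  have int: "integrable P (\<lambda>A. f (X i A) (X j A))"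
    if "i \<le> length \<sigma>" "j \<le> length \<sigma>" for i j and f :: "'a \<Rightarrow> 'a \<Rightarrow> real"
  proof (rule integrable_const_bound[where B = "Max ((\<lambda>(x, y). \<bar>f x y\<bar>) ` (M \<times> M))"])
    have XM: "X k A \<in> M" if "k \<le> length \<sigma>" "A \<in> space P" for k A
      using measurable_space[OF X[OF that(1)] that(2)] by simp
    show "AE A in P. norm (f (X i A) (X j A)) \<le> Max ((\<lambda>(x, y). \<bar>f x y\<bar>) ` (M \<times> M))"
      using M XM that by (intro AE_I2 Max_ge) (auto intro!: rev_image_eqI[of "(X i _, X j _)"])
    have "(\<lambda>A. (X i A, X j A)) \<in> P \<rightarrow>\<^sub>M count_space (M \<times> M)"
      using measurable_Pair[OF X X, OF that] M
      by (simp add: pair_measure_countable countable_finite)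
    from measurable_compose[OF this, of "\<lambda>(x, y). f x y" borel]
    show "(\<lambda>A. f (X i A) (X j A)) \<in> borel_measurable P" by simp
  qed
  have "integrable P (\<lambda>A. \<Sum>i<length \<sigma>. d (X i A) (X (Suc i) A) + (\<sigma> ! i) (X (Suc i) A))"
  proof (rule Bochner_Integration.integrable_sum)
    fix i assume "i \<in> {..<length \<sigma>}"
    then show "integrable P (\<lambda>A. d (X i A) (X (Suc i) A) + (\<sigma> ! i) (X (Suc i) A))"
      using int[of i "Suc i" "\<lambda>x y. d x y + (\<sigma> ! i) y"] by simp
  qed
  then show ?thesis
    by (simp add: schedule_cost_def X_def)
qed

end

theory Submission
  imports Defs
begin

text \<open>
  On a line, a fractional algorithm (a probability vector after each history) is rounded without
  loss by following its quantile at one uniformly random level: the expected movement is the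
  \<open>L\<^sub>1\<close>-distance of consecutive distribution functions.

  The fractional algorithm averages, over the shifts \<open>s < 2 ^ K\<close> of the line inside
  \<open>{..<2 ^ (K + 1)}\<close>, algorithms for the dyadic tree. Such a tree algorithm keeps virtual work
  values at the leaves and aggregates them bottom-up by a smoothed minimum
  \<open>G d a b = (a + b) / 2 - (a - b)\<^sup>2 / (4 * d) - d / 4\<close>, where \<open>d = 2 ^ k\<close> at a node whose two
  children have height \<open>k\<close>; the mass is split according to the gradient of \<open>G\<close>. Costs that would
  make \<open>\<bar>a - b\<bar>\<close> exceed \<open>d\<close> are discarded, which is harmless because the affected child then
  carries no mass. The value at the root increases by at least the service cost (\<open>G\<close> is concave),
  and by at most the cost of any offline player who pays \<open>tree_dist\<close> for moving. The movement of
  the algorithm is \<open>O(K)\<close> times that increase, up to a bounded potential. Averaging over the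
  shifts turns \<open>tree_dist\<close> into at most \<open>K + 1\<close> times the distance on the line, so that
  \<open>O(K\<^sup>2)\<close> results.
\<close>

section \<open>Balancing two subtrees\<close>

text \<open>
  In \<open>Node k D l r\<close>, \<open>k\<close> is the height of \<open>l\<close> and \<open>r\<close>, and \<open>D\<close> is the aggregated value of \<open>l\<close>
  minus that of \<open>r\<close>.
\<close>

datatype tree = Leaf | Node nat real tree tree

inductive valid :: "nat \<Rightarrow> tree \<Rightarrow> bool" where
  Leaf: "valid 0 Leaf"
| Node: "\<bar>D\<bar> \<le> 2 ^ k \<Longrightarrow> valid k l \<Longrightarrow> valid k r \<Longrightarrow> valid (Suc k) (Node k D l r)"

text \<open>The partial derivative of \<open>G (2 ^ k) a b\<close> in \<open>a\<close> where
  \<open>a - b = D\<close>. It falls from 1 at \<open>D = - (2 ^ k)\<close> to 0 at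
  \<open>D = 2 ^ k\<close>.\<close>

definition lweight :: "nat \<Rightarrow> real \<Rightarrow> real" where
  "lweight k D = (1 - D / 2 ^ k) / 2"

primrec prob :: "tree \<Rightarrow> nat \<Rightarrow> real" where
  "prob Leaf i = 1"
| "prob (Node k D l r) i =
     (if i < 2 ^ k then lweight k D * prob l i else (1 - lweight k D) * prob r (i - 2 ^ k))"

text \<open>The virtual work of a leaf relative to the aggregated value of the tree.\<close>

primrec off :: "tree \<Rightarrow> nat \<Rightarrow> real" where
  "off Leaf i = 0"
| "off (Node k D l r) i =
     (if i < 2 ^ k then off l i + (2 ^ k + D)\<^sup>2 / (4 * 2 ^ k)
      else off r (i - 2 ^ k) + (2 ^ k - D)\<^sup>2 / (4 * 2 ^ k))"

text \<open>The coefficient \<open>3 / 4\<close> is fitted to \<open>move_step\<close>: the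
  quadratic excess in \<open>lweight_change\<close>, taken three times, is exactly the increase of
  the last summand.\<close>

primrec pot :: "tree \<Rightarrow> real" where
  "pot Leaf = 0"
| "pot (Node k D l r) =
     lweight k D * pot l + (1 - lweight k D) * pot r + 3 / 4 * D\<^sup>2 / 2 ^ k"

text \<open>
  If the values of the two subtrees are due to increase by \<open>u\<close> and \<open>v\<close>, then \<open>ladv k D u v\<close> and
  \<open>ladv k (- D) v u\<close> are the increases left after capping the difference, \<open>tilt k D u v\<close> is the
  new difference, and \<open>rise k D u v\<close> is the increase of the smoothed minimum.
\<close>

definition ladv :: "nat \<Rightarrow> real \<Rightarrow> real \<Rightarrow> real \<Rightarrow> real" where
  "ladv k D u v = min u (v - D + 2 ^ k)"

definition tilt :: "nat \<Rightarrow> real \<Rightarrow> real \<Rightarrow> real \<Rightarrow> real" where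
  "tilt k D u v = D + ladv k D u v - ladv k (- D) v u"

definition rise :: "nat \<Rightarrow> real \<Rightarrow> real \<Rightarrow> real \<Rightarrow> real" where
  "rise k D u v =
     (ladv k D u v + ladv k (- D) v u) / 2 - ((tilt k D u v)\<^sup>2 - D\<^sup>2) / (4 * 2 ^ k)"

primrec gain :: "tree \<Rightarrow> (nat \<Rightarrow> real) \<Rightarrow> real" where
  "gain Leaf c = c 0"
| "gain (Node k D l r) c = rise k D (gain l c) (gain r (\<lambda>j. c (j + 2 ^ k)))"

primrec step :: "tree \<Rightarrow> (nat \<Rightarrow> real) \<Rightarrow> tree" where
  "step Leaf c = Leaf"
| "step (Node k D l r) c =
     Node k (tilt k D (gain l c) (gain r (\<lambda>j. c (j + 2 ^ k))))
       (step l c) (step r (\<lambda>j. c (j + 2 ^ k)))"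

lemma lweight_range:
  assumes "\<bar>D\<bar> \<le> 2 ^ k"
  shows "0 \<le> lweight k D" "lweight k D \<le> 1"
proof -
  have "-1 \<le> D / 2 ^ k" "D / 2 ^ k \<le> 1"
    using assms by (auto simp: divide_simps)
  then show "0 \<le> lweight k D" "lweight k D \<le> 1"
    by (auto simp: lweight_def)
qed

context
  fixes k :: nat and D u v :: real
  assumes D: "\<bar>D\<bar> \<le> 2 ^ k" and u: "0 \<le> u" and v: "0 \<le> v"
begin

lemma ladv_nonneg: "0 \<le> ladv k D u v" "0 \<le> ladv k (- D) v u"
  using D u v by (auto simp: ladv_def)

lemma ladv_le: "ladv k D u v \<le> u" "ladv k (- D) v u \<le> v"
  by (auto simp: ladv_def)

lemma tilt_range: "\<bar>tilt k D u v\<bar> \<le> 2 ^ k"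
  using D u v by (auto simp: tilt_def ladv_def min_def)

text \<open>At most one side is capped, and then the new difference sits at the end of its range
  where that child has weight 0.\<close>

lemma lweight_tilt_cases:
  "ladv k D u v = u \<or> lweight k (tilt k D u v) = 0"
  "ladv k (- D) v u = v \<or> lweight k (tilt k D u v) = 1"
proof -
  have pos: "(0::real) < 2 ^ k" by simp
  have "tilt k D u v = 2 ^ k" if "ladv k D u v \<noteq> u"
    using that pos unfolding ladv_def tilt_def by linarith
  then have "ladv k D u v = u \<or> tilt k D u v = 2 ^ k" by blast
  then show "ladv k D u v = u \<or> lweight k (tilt k D u v) = 0"
    by (auto simp: lweight_def)
  have "tilt k D u v = - (2 ^ k)" if "ladv k (- D) v u \<noteq> v"
    using that pos unfolding ladv_def tilt_def by linarith
  then have "ladv k (- D) v u = v \<or> tilt k D u v = - (2 ^ k)" by blast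
  then show "ladv k (- D) v u = v \<or> lweight k (tilt k D u v) = 1"
    by (auto simp: lweight_def)
qed

text \<open>Concavity of the smoothed minimum; the difference of the two sides is
  \<open>(tilt k D u v - D)\<^sup>2 / (4 * 2 ^ k)\<close>.\<close>

lemma weighted_le_rise:
  "lweight k (tilt k D u v) * u + (1 - lweight k (tilt k D u v)) * v \<le> rise k D u v"
proof -
  define D' where "D' = tilt k D u v"
  define a b where "a = ladv k D u v" and "b = ladv k (- D) v u"
  have D': "D' = D + a - b" by (simp add: D'_def a_def b_def tilt_def)
  have "lweight k D' * u = lweight k D' * a" "(1 - lweight k D') * v = (1 - lweight k D') * b"
    using lweight_tilt_cases by (auto simp: D'_def a_def b_def)
  then have "rise k D u v - (lweight k D' * u + (1 - lweight k D') * v)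
     = (a + b) / 2 - (D'\<^sup>2 - D\<^sup>2) / (4 * 2 ^ k) - (lweight k D' * a + (1 - lweight k D') * b)"
    by (simp only: rise_def flip: D'_def a_def b_def)
  also have "\<dots> = (D' - D)\<^sup>2 / (4 * 2 ^ k)"
    by (simp add: lweight_def D' field_simps power2_eq_square)
  also have "\<dots> \<ge> 0" by simp
  finally show ?thesis by (simp add: D'_def)
qed

lemma rise_nonneg: "0 \<le> rise k D u v"
proof -
  have "0 \<le> lweight k (tilt k D u v) * u + (1 - lweight k (tilt k D u v)) * v"
    using lweight_range[OF tilt_range] u v by simp
  with weighted_le_rise show ?thesis by linarith
qed

text \<open>\<open>lweight\<close> is linear in the difference, which changes by at most the sum of
  the two nonnegative capped increases. Half of that sum is the rise plus a quadratic term, to be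
  absorbed by \<open>pot\<close>.\<close>

lemma lweight_change:
  "\<bar>lweight k (tilt k D u v) - lweight k D\<bar> * 2 ^ k
     \<le> rise k D u v + ((tilt k D u v)\<^sup>2 - D\<^sup>2) / (4 * 2 ^ k)"
proof -
  have "\<bar>lweight k (tilt k D u v) - lweight k D\<bar> * 2 ^ k = \<bar>tilt k D u v - D\<bar> / 2"
    by (simp add: lweight_def abs_if field_simps)
  also have "\<dots> \<le> (ladv k D u v + ladv k (- D) v u) / 2"
    using ladv_nonneg by (simp add: tilt_def)
  finally show ?thesis by (simp add: rise_def)
qed

text \<open>The square over \<open>4 * 2 ^ k\<close> is the child's value minus the smoothed
  minimum. The two sides differ by exactly the cost discarded at that child.\<close>

lemma off_change:
  "(2 ^ k + tilt k D u v)\<^sup>2 / (4 * 2 ^ k) + rise k D u v \<le> (2 ^ k + D)\<^sup>2 / (4 * 2 ^ k) + u"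
  "(2 ^ k - tilt k D u v)\<^sup>2 / (4 * 2 ^ k) + rise k D u v \<le> (2 ^ k - D)\<^sup>2 / (4 * 2 ^ k) + v"
proof -
  define a b where "a = ladv k D u v" and "b = ladv k (- D) v u"
  have t: "tilt k D u v = D + a - b" by (simp add: a_def b_def tilt_def)
  have r: "rise k D u v = (a + b) / 2 - ((D + a - b)\<^sup>2 - D\<^sup>2) / (4 * 2 ^ k)"
    by (simp add: rise_def t a_def b_def)
  have "(2 ^ k + tilt k D u v)\<^sup>2 / (4 * 2 ^ k) + rise k D u v = (2 ^ k + D)\<^sup>2 / (4 * 2 ^ k) + a"
    unfolding r t by (simp add: field_simps power2_eq_square)
  then show "(2 ^ k + tilt k D u v)\<^sup>2 / (4 * 2 ^ k) + rise k D u v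
      \<le> (2 ^ k + D)\<^sup>2 / (4 * 2 ^ k) + u"
    using ladv_le by (simp add: a_def)
  have "(2 ^ k - tilt k D u v)\<^sup>2 / (4 * 2 ^ k) + rise k D u v = (2 ^ k - D)\<^sup>2 / (4 * 2 ^ k) + b"
    unfolding r t by (simp add: field_simps power2_eq_square)
  then show "(2 ^ k - tilt k D u v)\<^sup>2 / (4 * 2 ^ k) + rise k D u v
      \<le> (2 ^ k - D)\<^sup>2 / (4 * 2 ^ k) + v"
    using ladv_le by (simp add: b_def)
qed

end

section \<open>The algorithm on the dyadic tree\<close>

lemma gain_nonneg: "valid k T \<Longrightarrow> (\<And>i. 0 \<le> c i) \<Longrightarrow> 0 \<le> gain T c"
  by (induction arbitrary: c rule: valid.induct) (auto intro!: rise_nonneg)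

lemma valid_step: "valid k T \<Longrightarrow> (\<And>i. 0 \<le> c i) \<Longrightarrow> valid k (step T c)"
  by (induction arbitrary: c rule: valid.induct)
    (auto intro!: valid.intros tilt_range gain_nonneg)

text \<open>Apply \<open>off_change\<close> along the path to the leaf: the gains of inner nodes
  cancel, leaving only \<open>c i\<close> and the gain of the root.\<close>

lemma off_step:
  "valid k T \<Longrightarrow> (\<And>i. 0 \<le> c i) \<Longrightarrow> i < 2 ^ k \<Longrightarrow> off (step T c) i + gain T c \<le> off T i + c i"
proof (induction arbitrary: c i rule: valid.induct)
  case Leaf
  then show ?case by simp
next
  case (Node D k l r)
  let ?R = "\<lambda>j. c (j + 2 ^ k)"
  note ch = off_change[OF Node.hyps(1) gain_nonneg[OF Node.hyps(2), of c] gain_nonneg[OF Node.hyps(3), of ?R]]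
  show ?case
  proof (cases "i < 2 ^ k")
    case True
    then show ?thesis
      using ch(1) Node.IH(1)[of c i] Node.prems by simp
  next
    case False
    then have "i - 2 ^ k < 2 ^ k" using Node.prems(2) by simp
    then show ?thesis
      using ch(2) Node.IH(2)[of ?R "i - 2 ^ k"] Node.prems(1) False by simp
  qed
qed

lemma sum_lessThan_add:
  fixes f :: "nat \<Rightarrow> 'a::comm_monoid_add"
  shows "(\<Sum>i<n + m. f i) = (\<Sum>i<n. f i) + (\<Sum>i<m. f (i + n))"
  by (induction m) (simp_all add: add.assoc add.commute[of n])

lemma sum_halves:
  fixes f :: "nat \<Rightarrow> 'a::comm_monoid_add"
  shows "(\<Sum>i<2 ^ Suc k. f i) = (\<Sum>i<2 ^ k. f i) + (\<Sum>i<2 ^ k. f (i + 2 ^ k))"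
  using sum_lessThan_add[of f "2 ^ k" "2 ^ k"] by (simp add: mult_2)

lemma prob_nonneg: "valid k T \<Longrightarrow> 0 \<le> prob T i"
  by (induction arbitrary: i rule: valid.induct) (auto simp: lweight_range)

lemma sum_prob_Node:
  "(\<Sum>i<2 ^ Suc k. prob (Node k D l r) i * c i) =
     lweight k D * (\<Sum>i<2 ^ k. prob l i * c i)
       + (1 - lweight k D) * (\<Sum>i<2 ^ k. prob r i * c (i + 2 ^ k))"
  unfolding sum_halves by (simp add: sum_distrib_left mult.assoc)

lemma sum_prob: "valid k T \<Longrightarrow> (\<Sum>i<2 ^ k. prob T i) = 1"
proof (induction rule: valid.induct)
  case (Node D k l r)
  then show ?case using sum_prob_Node[of k D l r "\<lambda>_. 1"] by simp
qed simp

text \<open>A task is served after the move, hence the weights of the new tree. For these weights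
  \<open>weighted_le_rise\<close> carries the bound from the children to their parent.\<close>

lemma hit_le_gain:
  "valid k T \<Longrightarrow> (\<And>i. 0 \<le> c i) \<Longrightarrow> (\<Sum>i<2 ^ k. prob (step T c) i * c i) \<le> gain T c"
proof (induction arbitrary: c rule: valid.induct)
  case Leaf
  then show ?case by simp
next
  case (Node D k l r)
  let ?R = "\<lambda>j. c (j + 2 ^ k)"
  note uv = gain_nonneg[OF Node.hyps(2), of c] gain_nonneg[OF Node.hyps(3), of ?R]
  let ?q = "lweight k (tilt k D (gain l c) (gain r ?R))"
  have q: "0 \<le> ?q" "?q \<le> 1"
    using lweight_range[OF tilt_range] Node.hyps(1) uv Node.prems by auto
  have "(\<Sum>i<2 ^ Suc k. prob (step (Node k D l r) c) i * c i)
      = ?q * (\<Sum>i<2 ^ k. prob (step l c) i * c i) + (1 - ?q) * (\<Sum>i<2 ^ k. prob (step r ?R) i * ?R i)"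
    unfolding step.simps sum_prob_Node ..
  also have "\<dots> \<le> ?q * gain l c + (1 - ?q) * gain r ?R"
    using Node.IH(1)[of c] Node.IH(2)[of ?R] q Node.prems by (intro add_mono mult_left_mono) auto
  also have "\<dots> \<le> rise k D (gain l c) (gain r ?R)"
    using weighted_le_rise Node.hyps(1) uv Node.prems by blast
  finally show ?case by simp
qed

section \<open>Potential and movement of the tree algorithm\<close>

lemma pot_range: "valid k T \<Longrightarrow> 0 \<le> pot T \<and> pot T \<le> 2 ^ k"
proof (induction rule: valid.induct)
  case Leaf
  then show ?case by simp
next
  case (Node D k l r)
  note q = lweight_range[OF Node.hyps(1)]
  have "lweight k D * pot l + (1 - lweight k D) * pot r \<le> lweight k D * 2 ^ k + (1 - lweight k D) * 2 ^ k"
    using q Node.IH by (intro add_mono mult_left_mono) auto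
  then have "lweight k D * pot l + (1 - lweight k D) * pot r \<le> 2 ^ k"
    by (simp add: algebra_simps)
  moreover have "D\<^sup>2 \<le> (2 ^ k)\<^sup>2"
    using Node.hyps(1) by (metis abs_ge_zero power2_abs power_mono)
  then have "D\<^sup>2 / 2 ^ k \<le> 2 ^ k"
    by (simp add: divide_simps power2_eq_square)
  moreover have "0 \<le> D\<^sup>2 / 2 ^ k" by simp
  moreover have "0 \<le> lweight k D * pot l + (1 - lweight k D) * pot r"
    using q Node.IH by simp
  moreover have "pot (Node k D l r) =
      lweight k D * pot l + (1 - lweight k D) * pot r + 3 / 4 * (D\<^sup>2 / 2 ^ k)"
    by simp
  ultimately show ?case unfolding power_Suc by linarith
qed

definition cum :: "tree \<Rightarrow> nat \<Rightarrow> real" where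
  "cum T m = (\<Sum>i<m. prob T i)"

text \<open>The cost of transporting the mass along the line of leaves. \<open>tree_dist\<close> is
  charged to the offline player only.\<close>

definition move :: "nat \<Rightarrow> tree \<Rightarrow> tree \<Rightarrow> real" where
  "move k T T' = (\<Sum>m<2 ^ k. \<bar>cum T' m - cum T m\<bar>)"

lemma cum_range:
  assumes "valid k T" "m \<le> 2 ^ k"
  shows "0 \<le> cum T m" "cum T m \<le> 1"
proof -
  show "0 \<le> cum T m"
    unfolding cum_def by (intro sum_nonneg) (use assms prob_nonneg in auto)
  have "cum T m \<le> (\<Sum>i<2 ^ k. prob T i)"
    unfolding cum_def by (intro sum_mono2) (use assms prob_nonneg in auto)
  then show "cum T m \<le> 1" using sum_prob[OF assms(1)] by simp
qed

lemma cum_Node_left: "m \<le> 2 ^ k \<Longrightarrow> cum (Node k D l r) m = lweight k D * cum l m"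
  by (simp add: cum_def sum_distrib_left)

lemma cum_Node_right:
  assumes "valid k l"
  shows "cum (Node k D l r) (m + 2 ^ k) = lweight k D + (1 - lweight k D) * cum r m"
proof -
  have "cum (Node k D l r) (2 ^ k + m) =
      (\<Sum>i<2 ^ k. prob (Node k D l r) i) + (\<Sum>i<m. prob (Node k D l r) (i + 2 ^ k))"
    unfolding cum_def by (rule sum_lessThan_add)
  then show ?thesis
    using sum_prob[OF assms]
    by (simp add: add.commute cum_def sum_distrib_left[symmetric])
qed

text \<open>Each difference splits into a change inside a child, at the new weight, and a change of
  weight. The latter costs at most the absolute weight change at each of \<open>2 * 2 ^ k\<close>
  positions.\<close>

lemma move_Node:
  assumes "valid k l" "valid k r" "valid k l'" "valid k r'" "\<bar>D'\<bar> \<le> 2 ^ k"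
  shows "move (Suc k) (Node k D l r) (Node k D' l' r') \<le>
     lweight k D' * move k l l' + (1 - lweight k D') * move k r r'
       + 2 * 2 ^ k * \<bar>lweight k D' - lweight k D\<bar>"
proof -
  define q q' where "q = lweight k D" and "q' = lweight k D'"
  have q': "0 \<le> q'" "q' \<le> 1" using lweight_range[OF assms(5)] by (auto simp: q'_def)
  have L: "\<bar>q' * cum l' m - q * cum l m\<bar> \<le> q' * \<bar>cum l' m - cum l m\<bar> + \<bar>q' - q\<bar>"
    if "m < 2 ^ k" for m
  proof -
    have "q' * cum l' m - q * cum l m = q' * (cum l' m - cum l m) + (q' - q) * cum l m"
      by (simp add: algebra_simps)
    also have "\<bar>\<dots>\<bar> \<le> \<bar>q' * (cum l' m - cum l m)\<bar> + \<bar>(q' - q) * cum l m\<bar>"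
      by (rule abs_triangle_ineq)
    also have "\<dots> \<le> q' * \<bar>cum l' m - cum l m\<bar> + \<bar>q' - q\<bar> * 1"
      unfolding abs_mult using q' cum_range[OF assms(1), of m] that
      by (intro add_mono mult_left_mono) auto
    finally show ?thesis by simp
  qed
  have R: "\<bar>(q' + (1 - q') * cum r' m) - (q + (1 - q) * cum r m)\<bar>
      \<le> (1 - q') * \<bar>cum r' m - cum r m\<bar> + \<bar>q' - q\<bar>"
    if "m < 2 ^ k" for m
  proof -
    have "(q' + (1 - q') * cum r' m) - (q + (1 - q) * cum r m)
        = (1 - q') * (cum r' m - cum r m) + (q' - q) * (1 - cum r m)"
      by (simp add: algebra_simps)
    also have "\<bar>\<dots>\<bar> \<le> \<bar>(1 - q') * (cum r' m - cum r m)\<bar> + \<bar>(q' - q) * (1 - cum r m)\<bar>"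
      by (rule abs_triangle_ineq)
    also have "\<dots> \<le> (1 - q') * \<bar>cum r' m - cum r m\<bar> + \<bar>q' - q\<bar> * 1"
      unfolding abs_mult using q' cum_range[OF assms(2), of m] that
      by (intro add_mono mult_left_mono) auto
    finally show ?thesis by simp
  qed
  have "move (Suc k) (Node k D l r) (Node k D' l' r') =
      (\<Sum>m<2 ^ k. \<bar>q' * cum l' m - q * cum l m\<bar>)
        + (\<Sum>m<2 ^ k. \<bar>(q' + (1 - q') * cum r' m) - (q + (1 - q) * cum r m)\<bar>)"
    unfolding move_def sum_halves
    by (simp add: cum_Node_left cum_Node_right assms q_def q'_def)
  also have "\<dots> \<le> (\<Sum>m<2 ^ k. q' * \<bar>cum l' m - cum l m\<bar> + \<bar>q' - q\<bar>)
      + (\<Sum>m<2 ^ k. (1 - q') * \<bar>cum r' m - cum r m\<bar> + \<bar>q' - q\<bar>)"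
    by (intro add_mono sum_mono L R) auto
  also have "\<dots> = q' * move k l l' + (1 - q') * move k r r' + 2 * 2 ^ k * \<bar>q' - q\<bar>"
    by (simp add: move_def sum.distrib sum_distrib_left)
  finally show ?thesis by (simp add: q_def q'_def)
qed

text \<open>Each level adds \<open>3 * rise\<close>: a unit of mass transferred between the children
  costs \<open>2 * 2 ^ k\<close> by \<open>move_Node\<close> and at most another
  \<open>2 ^ k\<close> through the difference of the children's potentials.\<close>

lemma move_step:
  "valid k T \<Longrightarrow> (\<And>i. 0 \<le> c i) \<Longrightarrow>
     move k T (step T c) \<le> 3 * real k * gain T c + pot (step T c) - pot T"
proof (induction arbitrary: c rule: valid.induct)
  case Leaf
  then show ?case by (simp add: move_def)
next
  case (Node D k l r)
  let ?R = "\<lambda>j. c (j + 2 ^ k)"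
  define u v where "u = gain l c" and "v = gain r ?R"
  have uv: "0 \<le> u" "0 \<le> v"
    using gain_nonneg Node.hyps Node.prems by (auto simp: u_def v_def)
  define D' where "D' = tilt k D u v"
  define q q' where "q = lweight k D" and "q' = lweight k D'"
  define l' r' where "l' = step l c" and "r' = step r ?R"
  have D': "\<bar>D'\<bar> \<le> 2 ^ k" using tilt_range[OF Node.hyps(1) uv] by (simp add: D'_def)
  have q': "0 \<le> q'" "q' \<le> 1" using lweight_range[OF D'] by (auto simp: q'_def)
  have val: "valid k l'" "valid k r'"
    using valid_step Node.hyps Node.prems by (auto simp: l'_def r'_def)
  have "move (Suc k) (Node k D l r) (Node k D' l' r') \<le>
      q' * move k l l' + (1 - q') * move k r r' + 2 * 2 ^ k * \<bar>q' - q\<bar>"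
    unfolding q_def q'_def using move_Node[OF Node.hyps(2,3) val D'] .
  also have "\<dots> \<le> q' * (3 * real k * u + pot l' - pot l) + (1 - q') * (3 * real k * v + pot r' - pot r)
      + 2 * 2 ^ k * \<bar>q' - q\<bar>"
    using Node.IH(1)[of c] Node.IH(2)[of ?R] q' Node.prems
    by (intro add_mono mult_left_mono order.refl) (auto simp: u_def v_def l'_def r'_def)
  \<comment> \<open>The old potentials are brought from the new weights back to the old ones; the
    correction is the term in \<open>pot r - pot l\<close>.\<close>
  also have "\<dots> = 3 * real k * (q' * u + (1 - q') * v)
      + (q' * pot l' + (1 - q') * pot r') - (q * pot l + (1 - q) * pot r)
      + (q' - q) * (pot r - pot l) + 2 * 2 ^ k * \<bar>q' - q\<bar>"
    by (simp add: algebra_simps)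
  also have "\<dots> \<le> 3 * real k * rise k D u v
      + (q' * pot l' + (1 - q') * pot r') - (q * pot l + (1 - q) * pot r)
      + \<bar>q' - q\<bar> * 2 ^ k + 2 * 2 ^ k * \<bar>q' - q\<bar>"
  proof -
    have 1: "3 * real k * (q' * u + (1 - q') * v) \<le> 3 * real k * rise k D u v"
      using weighted_le_rise[OF Node.hyps(1) uv] by (intro mult_left_mono) (auto simp: q'_def D'_def)
    have "(q' - q) * (pot r - pot l) \<le> \<bar>q' - q\<bar> * \<bar>pot r - pot l\<bar>"
      by (metis abs_ge_self abs_mult)
    also have "\<dots> \<le> \<bar>q' - q\<bar> * 2 ^ k"
      using pot_range[OF Node.hyps(2)] pot_range[OF Node.hyps(3)] by (intro mult_left_mono) auto
    finally show ?thesis using 1 by linarith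
  qed
  also have "\<dots> = 3 * real k * rise k D u v
      + (q' * pot l' + (1 - q') * pot r') - (q * pot l + (1 - q) * pot r) + 3 * (\<bar>q' - q\<bar> * 2 ^ k)"
    by simp
  also have "\<dots> \<le> 3 * real k * rise k D u v
      + (q' * pot l' + (1 - q') * pot r') - (q * pot l + (1 - q) * pot r)
      + 3 * (rise k D u v + (D'\<^sup>2 - D\<^sup>2) / (4 * 2 ^ k))"
    unfolding q_def q'_def D'_def
    by (intro add_left_mono mult_left_mono lweight_change[OF Node.hyps(1) uv]) simp
  also have "\<dots> = 3 * real (Suc k) * rise k D u v + pot (Node k D' l' r') - pot (Node k D l r)"
    by (simp add: q_def q'_def field_simps)
  finally show ?case
    by (simp add: u_def v_def D'_def l'_def r'_def)
qed

section \<open>Tree distance: its effect on \<open>off\<close> and its average over shifts\<close>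

definition tree_dist :: "nat \<Rightarrow> nat \<Rightarrow> nat \<Rightarrow> real" where
  "tree_dist k i j = (\<Sum>m<k. if i div 2 ^ m = j div 2 ^ m then 0 else 2 ^ m)"

lemma off_shift_range:
  assumes "\<bar>D\<bar> \<le> 2 ^ k"
  shows "(2 ^ k + D)\<^sup>2 / (4 * 2 ^ k) \<le> 2 ^ k" "(2 ^ k - D)\<^sup>2 / (4 * 2 ^ k) \<le> (2 ^ k :: real)"
proof -
  have "(2 ^ k + D)\<^sup>2 \<le> (2 * 2 ^ k)\<^sup>2" "(2 ^ k - D)\<^sup>2 \<le> (2 * 2 ^ k)\<^sup>2"
    using assms by (intro power_mono; simp)+
  then show "(2 ^ k + D)\<^sup>2 / (4 * 2 ^ k) \<le> 2 ^ k" "(2 ^ k - D)\<^sup>2 / (4 * 2 ^ k) \<le> (2 ^ k :: real)"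
    by (auto simp: divide_simps power2_eq_square)
qed

lemma off_range: "valid k T \<Longrightarrow> 0 \<le> off T i \<and> off T i \<le> (\<Sum>m<k. 2 ^ m)"
proof (induction arbitrary: i rule: valid.induct)
  case (Node D k l r)
  then show ?case
    using off_shift_range[OF Node.hyps(1)] Node.IH(1)[of i] Node.IH(2)[of "i - 2 ^ k"]
    by (auto intro!: add_mono)
qed simp

text \<open>Leaves below the same child share the top summand of \<open>off\<close>, which cancels.
  Leaves below different children are separated at every level, so \<open>tree_dist\<close> equals
  the upper bound in \<open>off_range\<close>.\<close>

lemma off_diff: "valid k T \<Longrightarrow> i < 2 ^ k \<Longrightarrow> j < 2 ^ k \<Longrightarrow> off T i - off T j \<le> tree_dist k i j"
proof (induction arbitrary: i j rule: valid.induct)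
  case Leaf
  then show ?case by (simp add: tree_dist_def)
next
  case (Node D k l r)
  have div_eq: "i div 2 ^ k = 0 \<longleftrightarrow> i < 2 ^ k" for i :: nat
    by (simp add: div_eq_0_iff)
  have sep: "tree_dist (Suc k) i j = (\<Sum>m<Suc k. 2 ^ m)" if ne: "(i < 2 ^ k) \<noteq> (j < 2 ^ k)"
  proof -
    have "i div 2 ^ m \<noteq> j div 2 ^ m" if "m < Suc k" for m
    proof
      assume "i div 2 ^ m = j div 2 ^ m"
      then have "i div 2 ^ m div 2 ^ (k - m) = j div 2 ^ m div 2 ^ (k - m)" by simp
      then have "i div 2 ^ k = j div 2 ^ k"
        using that by (simp add: div_mult2_eq[symmetric] power_add[symmetric])
      with ne div_eq show False by metis
    qed
    then show ?thesis by (simp add: tree_dist_def)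
  qed
  have le: "tree_dist k i j \<le> tree_dist (Suc k) i j" for i j by (simp add: tree_dist_def)
  consider "i < 2 ^ k" "j < 2 ^ k" | "\<not> i < 2 ^ k" "\<not> j < 2 ^ k" | "(i < 2 ^ k) \<noteq> (j < 2 ^ k)"
    by blast
  then show ?case
  proof cases
    case 1
    then show ?thesis using Node.IH(1)[of i j] le[of i j] by simp
  next
    case 2
    define i' j' where "i' = i - 2 ^ k" and "j' = j - 2 ^ k"
    have ij: "i = i' + 2 ^ k" "j = j' + 2 ^ k" using 2 by (auto simp: i'_def j'_def)
    \<comment> \<open>\<open>2 ^ k\<close> is a multiple of the block length, so the shift renumbers
      all blocks of level \<open>m\<close> by the same amount.\<close>
    have "(x + 2 ^ k) div 2 ^ m = x div 2 ^ m + 2 ^ (k - m)" if "m < k" for x m :: nat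
    proof -
      have "(2::nat) ^ k = 2 ^ (k - m) * 2 ^ m" using that by (simp add: power_add[symmetric])
      then show ?thesis by simp
    qed
    then have "tree_dist k i j = tree_dist k i' j'"
      unfolding tree_dist_def ij by (intro sum.cong) auto
    then show ?thesis using Node.IH(2)[of i' j'] le[of i j] Node.prems by (simp add: ij)
  next
    case 3
    have "valid (Suc k) (Node k D l r)" using Node.hyps by (intro valid.intros)
    from off_range[OF this, of i] off_range[OF this, of j] sep[OF 3] show ?thesis by linarith
  qed
qed


text \<open>Raising \<open>e\<close> by one makes the sum telescope to \<open>(i + e + N) div m - (i + e) div m\<close>.\<close>

lemma sum_div_shift:
  fixes i e m N :: nat
  assumes "m dvd N"
  shows "(\<Sum>s<N. (i + e + s) div m) = (\<Sum>s<N. (i + s) div m) + e * (N div m)"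
proof (induction e)
  case 0
  then show ?case by simp
next
  case (Suc e)
  let ?a = "i + e"
  have "(\<Sum>s<N. (?a + Suc s) div m) + ?a div m = (\<Sum>s<N. (?a + s) div m) + (?a + N) div m"
    using sum.lessThan_Suc_shift[of "\<lambda>s. (?a + s) div m" N] sum.lessThan_Suc[of "\<lambda>s. (?a + s) div m" N]
    by (simp add: add.commute)
  moreover have "(?a + N) div m = ?a div m + N div m"
    using assms by (rule div_plus_div_distrib_dvd_right)
  ultimately show ?case using Suc by simp
qed

text \<open>Two points at distance \<open>e\<close> are separated by blocks of length
  \<open>2 ^ m\<close> for at most a fraction \<open>e / 2 ^ m\<close> of the shifts. As level
  \<open>m\<close> costs \<open>2 ^ m\<close>, each of the \<open>K + 1\<close> levels contributes
  at most \<open>e\<close> on average.\<close>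

lemma sum_tree_dist_le:
  "(\<Sum>s<2 ^ K. tree_dist (Suc K) (i + s) (j + s)) \<le> 2 ^ K * (real (Suc K) * line_dist i j)"
proof (induction i j rule: linorder_wlog)
  case (sym i j)
  moreover have "tree_dist (Suc K) a b = tree_dist (Suc K) b a" for a b
    by (auto simp: tree_dist_def intro!: sum.cong)
  ultimately show ?case
    by (simp add: line_dist_def abs_minus_commute)
next
  case (le i j)
  then obtain e where j: "j = i + e" using le_Suc_ex by blast
  have level: "(\<Sum>s<2 ^ K. if (i + s) div 2 ^ m = (j + s) div 2 ^ m then 0 else 2 ^ m)
      \<le> 2 ^ K * real e" if "m < Suc K" for m
  proof -
    \<comment> \<open>Separation is bounded by the number of block boundaries crossed, whose sum
      over the shifts \<open>sum_div_shift\<close> gives exactly.\<close>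
    have "(\<Sum>s<2 ^ K. if (i + s) div 2 ^ m = (j + s) div 2 ^ m then 0 else 2 ^ m)
        \<le> (\<Sum>s<2 ^ K. 2 ^ m * (real ((j + s) div 2 ^ m) - real ((i + s) div 2 ^ m)))"
    proof (rule sum_mono)
      fix s
      have "(i + s) div 2 ^ m \<le> (j + s) div 2 ^ m" using le by (simp add: div_le_mono)
      then have "(i + s) div 2 ^ m = (j + s) div 2 ^ m \<or>
          1 \<le> real ((j + s) div 2 ^ m) - real ((i + s) div 2 ^ m)"
        by linarith
      then show "(if (i + s) div 2 ^ m = (j + s) div 2 ^ m then 0 else 2 ^ m)
          \<le> 2 ^ m * (real ((j + s) div 2 ^ m) - real ((i + s) div 2 ^ m))"
        by auto
    qed
    also have "\<dots> = 2 ^ m * (real (\<Sum>s<2 ^ K. (i + e + s) div 2 ^ m) - real (\<Sum>s<2 ^ K. (i + s) div 2 ^ m))"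
      by (simp add: j sum_distrib_left[symmetric] sum_subtractf)
    also have "\<dots> = 2 ^ m * real (e * (2 ^ K div 2 ^ m))"
      using that by (subst sum_div_shift) (auto simp: le_imp_power_dvd)
    also have "(2::nat) ^ K div 2 ^ m = 2 ^ (K - m)"
      using that by (simp add: power_diff)
    also have "2 ^ m * real (e * 2 ^ (K - m)) = 2 ^ K * real e"
      using that by (simp add: power_add[symmetric])
    finally show ?thesis .
  qed
  have "(\<Sum>s<2 ^ K. tree_dist (Suc K) (i + s) (j + s)) =
      (\<Sum>m<Suc K. \<Sum>s<2 ^ K. if (i + s) div 2 ^ m = (j + s) div 2 ^ m then 0 else 2 ^ m)"
    unfolding tree_dist_def by (rule sum.swap)
  also have "\<dots> \<le> (\<Sum>m<Suc K. 2 ^ K * real e)"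
    by (intro sum_mono level) simp
  also have "\<dots> = 2 ^ K * (real (Suc K) * line_dist i j)"
    by (simp add: j line_dist_def)
  finally show ?case .
qed

section \<open>Totals over a sequence of tasks\<close>

context
  fixes k :: nat and T :: "nat \<Rightarrow> tree" and c :: "nat \<Rightarrow> nat \<Rightarrow> real" and N :: nat
  assumes T0: "valid k (T 0)" and T: "\<And>t. t < N \<Longrightarrow> T (Suc t) = step (T t) (c t)"
    and c: "\<And>t i. t < N \<Longrightarrow> 0 \<le> c t i"
begin

lemma valid_run: "t \<le> N \<Longrightarrow> valid k (T t)"
  by (induction t) (auto simp: T0 T c intro!: valid_step)

lemma run_cost_le_gain:
  "(\<Sum>t<N. move k (T t) (T (Suc t)) + (\<Sum>i<2 ^ k. prob (T (Suc t)) i * c t i))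
     \<le> (3 * real k + 1) * (\<Sum>t<N. gain (T t) (c t)) + 2 ^ k"
proof -
  have "(\<Sum>t<N. move k (T t) (T (Suc t)) + (\<Sum>i<2 ^ k. prob (T (Suc t)) i * c t i))
      \<le> (\<Sum>t<N. (3 * real k + 1) * gain (T t) (c t) + (pot (T (Suc t)) - pot (T t)))"
  proof (rule sum_mono)
    fix t assume "t \<in> {..<N}"
    then have t: "t < N" by simp
    have pos: "0 \<le> c t i" for i using c t by simp
    from t show "move k (T t) (T (Suc t)) + (\<Sum>i<2 ^ k. prob (T (Suc t)) i * c t i)
        \<le> (3 * real k + 1) * gain (T t) (c t) + (pot (T (Suc t)) - pot (T t))"
      using move_step[OF valid_run[of t], of "c t"] hit_le_gain[OF valid_run[of t], of "c t"] T[OF t] pos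
      by (simp add: algebra_simps)
  qed
  also have "\<dots> = (3 * real k + 1) * (\<Sum>t<N. gain (T t) (c t)) + (pot (T N) - pot (T 0))"
    by (simp add: sum.distrib sum_distrib_left sum_lessThan_telescope[of "\<lambda>t. pot (T t)"])
  also have "\<dots> \<le> (3 * real k + 1) * (\<Sum>t<N. gain (T t) (c t)) + 2 ^ k"
    using pot_range[OF valid_run[of N]] pot_range[OF T0] by simp
  finally show ?thesis .
qed

text \<open>Amortization by the \<open>off\<close> of the offline player's current leaf:
  \<open>off_diff\<close> accounts for its moves, \<open>off_step\<close> for the tasks. The initial
  value is at most \<open>2 ^ k\<close>.\<close>

lemma gain_le_schedule:
  assumes y: "\<And>t. t \<le> N \<Longrightarrow> y t < 2 ^ k"
  shows "(\<Sum>t<N. gain (T t) (c t))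
     \<le> 2 ^ k + (\<Sum>t<N. tree_dist k (y t) (y (Suc t)) + c t (y (Suc t)))"
proof -
  have "off (T n) (y n) + (\<Sum>t<n. gain (T t) (c t))
      \<le> off (T 0) (y 0) + (\<Sum>t<n. tree_dist k (y t) (y (Suc t)) + c t (y (Suc t)))" if "n \<le> N" for n
    using that
  proof (induction n)
    case (Suc n)
    have pos: "0 \<le> c n i" for i using c Suc.prems by simp
    have "off (T (Suc n)) (y (Suc n)) + gain (T n) (c n) \<le> off (T n) (y (Suc n)) + c n (y (Suc n))"
      using off_step[OF valid_run[of n] pos y[of "Suc n"]] T[of n] Suc.prems by simp
    moreover have "off (T n) (y (Suc n)) - off (T n) (y n) \<le> tree_dist k (y (Suc n)) (y n)"
      using off_diff[OF valid_run[of n] y[of "Suc n"] y[of n]] Suc.prems by simp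
    moreover have "tree_dist k (y (Suc n)) (y n) = tree_dist k (y n) (y (Suc n))"
      by (auto simp: tree_dist_def intro!: sum.cong)
    ultimately show ?case using Suc by simp
  qed simp
  from this[of N] have "(\<Sum>t<N. gain (T t) (c t)) + off (T N) (y N)
      \<le> off (T 0) (y 0) + (\<Sum>t<N. tree_dist k (y t) (y (Suc t)) + c t (y (Suc t)))"
    by simp
  moreover have "(\<Sum>m<k. 2 ^ m) \<le> (2 ^ k :: real)"
    by (induction k) auto
  ultimately show ?thesis
    using off_range[OF T0, of "y 0"] off_range[OF valid_run[of N], of "y N"] by linarith
qed

end

section \<open>Rounding by quantiles\<close>

text \<open>
  For monotone \<open>F\<close> with \<open>F n = 1\<close> and \<open>0 < x \<le> 1\<close> this is the least \<open>j \<ge> 1\<close> with \<open>x \<le> F j\<close>;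
  counting makes it sensitive to \<open>F\<close> only through the indicators \<open>F k < x\<close>.
\<close>

definition quant :: "nat \<Rightarrow> (nat \<Rightarrow> real) \<Rightarrow> real \<Rightarrow> nat" where
  "quant n F x = 1 + (\<Sum>k\<in>{1..<n}. of_bool (F k < x))"

lemma quant_range:
  assumes "1 \<le> n"
  shows "quant n F x \<in> {1..n}"
proof -
  have "(\<Sum>k\<in>{1..<n}. of_bool (F k < x) :: nat) \<le> (\<Sum>k\<in>{1..<n}. 1)"
    by (intro sum_mono) auto
  then show ?thesis using assms by (simp add: quant_def)
qed

text \<open>The two counts differ at \<open>k\<close> only if \<open>x\<close> lies between
  \<open>F k\<close> and \<open>G k\<close>. For uniform \<open>x\<close> this event has probability
  \<open>\<bar>F k - G k\<bar>\<close>.\<close>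

lemma quant_diff_le:
  "\<bar>real (quant n F x) - real (quant n G x)\<bar>
     \<le> (\<Sum>k\<in>{1..<n}. indicator {min (F k) (G k)<..max (F k) (G k)} x)"
proof -
  have "real (quant n F x) - real (quant n G x)
      = (\<Sum>k\<in>{1..<n}. of_bool (F k < x) - of_bool (G k < x))"
    by (simp add: quant_def sum_subtractf)
  also have "\<bar>\<dots>\<bar> \<le> (\<Sum>k\<in>{1..<n}. \<bar>of_bool (F k < x) - of_bool (G k < x)\<bar>)"
    by (rule sum_abs)
  also have "\<dots> \<le> (\<Sum>k\<in>{1..<n}. indicator {min (F k) (G k)<..max (F k) (G k)} x)"
    by (intro sum_mono) (auto simp: indicator_def)
  finally show ?thesis .
qed

lemma quant_eqI:
  assumes "mono F" "1 \<le> j" "j \<le> n" "F (j - 1) < x" "x \<le> F j"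
  shows "quant n F x = j"
proof -
  have "F k < x \<longleftrightarrow> k < j" for k
  proof
    assume "F k < x"
    show "k < j"
    proof (rule ccontr)
      assume "\<not> k < j"
      then have "F j \<le> F k" using monoD[OF assms(1)] by simp
      with assms(5) \<open>F k < x\<close> show False by simp
    qed
  next
    assume "k < j"
    then have "F k \<le> F (j - 1)" using monoD[OF assms(1)] by simp
    with assms(4) show "F k < x" by simp
  qed
  then have "quant n F x = 1 + card ({1..<n} \<inter> {k. k < j})"
    by (simp add: quant_def)
  also have "{1..<n} \<inter> {k. k < j} = {1..<j}" using assms(3) by auto
  finally show ?thesis using assms(2) by simp
qed

lemma quant_hit_le:
  assumes F: "mono F" "F 0 = 0" "F n = 1" and x: "0 < x" "x \<le> 1"
    and c: "\<And>j. j \<in> {1..n} \<Longrightarrow> (0::real) \<le> c j"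
  shows "c (quant n F x) \<le> (\<Sum>j\<in>{1..n}. c j * indicator {F (j - 1)<..F j} x)"
proof -
  define j where "j = (LEAST j. x \<le> F j)"
  have xj: "x \<le> F j" unfolding j_def by (rule LeastI[of _ n]) (use F x in simp)
  have jn: "j \<le> n" unfolding j_def by (rule Least_le) (use F x in simp)
  have j1: "1 \<le> j" using xj F x by (cases j) auto
  have "F (j - 1) < x"
    using not_less_Least[of "j - 1" "\<lambda>j. x \<le> F j"] j1 by (simp add: j_def[symmetric])
  with F xj jn j1 have "quant n F x = j" by (intro quant_eqI) auto
  moreover have "c j = c j * indicator {F (j - 1)<..F j} x"
    using xj \<open>F (j - 1) < x\<close> by simp
  moreover have "\<dots> \<le> (\<Sum>j\<in>{1..n}. c j * indicator {F (j - 1)<..F j} x)"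
    using jn j1 c by (intro member_le_sum) auto
  ultimately show ?thesis by metis
qed

text \<open>0 is left out because the intervals \<open>{F (j - 1)<..F j}\<close> of a monotone
  \<open>F\<close> with \<open>F 0 = 0\<close> and \<open>F n = 1\<close> partition
  \<open>{0<..1}\<close>.\<close>

definition unif :: "real measure" where
  "unif = restrict_space lborel {0<..1}"

lemma prob_space_unif: "prob_space unif"
  unfolding unif_def by (rule prob_space_restrict_space) auto

lemma space_unif: "space unif = {0<..1}"
  by (simp add: unif_def space_restrict_space)

lemma measurable_quant:
  assumes "1 \<le> n"
  shows "quant n F \<in> unif \<rightarrow>\<^sub>M count_space {1..n}"
proof -
  have [measurable]: "(\<lambda>x. F k < x) \<in> borel \<rightarrow>\<^sub>M count_space UNIV" for k
    by measurable
  have "quant n F \<in> borel \<rightarrow>\<^sub>M count_space UNIV"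
    unfolding quant_def[abs_def] of_bool_def by measurable
  then have "quant n F \<in> unif \<rightarrow>\<^sub>M count_space UNIV"
    unfolding unif_def by (intro measurable_restrict_space1) simp
  then show ?thesis
    using quant_range[OF assms] by (auto simp: measurable_count_space_eq2 measurable_def)
qed

lemma has_bochner_integral_unif:
  assumes "0 \<le> a" "a \<le> b" "b \<le> 1"
  shows "has_bochner_integral unif (indicator {a<..b}) (b - a)"
proof -
  interpret prob_space unif by (rule prob_space_unif)
  have sub: "{a<..b} \<subseteq> {0<..1}" using assms by auto
  then have "{a<..b} \<in> sets unif"
    by (auto simp: unif_def sets_restrict_space_iff)
  moreover have "measure unif {a<..b} = b - a"
    unfolding unif_def using sub assms by (subst measure_restrict_space) auto
  ultimately show ?thesis
    by (metis has_bochner_integral_real_indicator emeasure_finite infinity_ennreal_def less_top)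
qed

definition partial_mass :: "(nat \<Rightarrow> real) \<Rightarrow> nat \<Rightarrow> real" where
  "partial_mass p k = (\<Sum>j\<in>{1..k}. p j)"

lemma quantile_rounding:
  fixes p :: "(nat \<Rightarrow> real) list \<Rightarrow> nat \<Rightarrow> real"
  assumes s: "s \<in> {1..n}"
    and p: "\<And>h j. h \<in> lists (tasks {1..n}) \<Longrightarrow> 0 \<le> p h j"
    and p1: "\<And>h. h \<in> lists (tasks {1..n}) \<Longrightarrow> (\<Sum>j\<in>{1..n}. p h j) = 1"
  shows "\<exists>P. randomized_algorithm {1..n} P \<and>
    (\<forall>\<sigma>\<in>lists (tasks {1..n}). expected_cost line_dist s P \<sigma> \<le>
      real n + (\<Sum>i<length \<sigma>.
        (\<Sum>k\<in>{1..<n}. \<bar>partial_mass (p (take (Suc i) \<sigma>)) k - partial_mass (p (take i \<sigma>)) k\<bar>)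
        + (\<Sum>j\<in>{1..n}. p (take (Suc i) \<sigma>) j * (\<sigma> ! i) j)))"
proof -
  have n: "1 \<le> n" using s by simp
  interpret U: prob_space unif by (rule prob_space_unif)
  define M where "M = Pi\<^sub>M (histories {1..n}) (\<lambda>_. count_space {1..n})"
  define Q where "Q h x = quant n (partial_mass (p h)) x" for h x
  \<comment> \<open>One level \<open>x\<close> serves all histories, so consecutive states are
    quantiles at the same level. The restriction makes \<open>R x\<close> extensional, as the
    product space demands.\<close>
  define R where "R x = (\<lambda>h\<in>histories {1..n}. Q h x)" for x
  define P where "P = distr unif M R"
  have R: "R \<in> unif \<rightarrow>\<^sub>M M"
    unfolding R_def M_def Q_def by (intro measurable_restrict measurable_quant n)
  have alg: "randomized_algorithm {1..n} P"
    unfolding randomized_algorithm_def P_def using U.prob_space_distr[OF R] by (simp add: M_def)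
  have mono: "mono (partial_mass (p h))" and cdf0: "partial_mass (p h) 0 = 0" and cdfn: "partial_mass (p h) n = 1"
    if "h \<in> lists (tasks {1..n})" for h
    using p[OF that] p1[OF that] by (auto simp: partial_mass_def intro!: monoI sum_mono2)
  have cdf_range: "0 \<le> partial_mass (p h) k" "partial_mass (p h) k \<le> 1"
    if "h \<in> lists (tasks {1..n})" "k \<le> n" for h k
    using monoD[OF mono[OF that(1)], of 0 k] monoD[OF mono[OF that(1)], of k n] that
      cdf0[OF that(1)] cdfn[OF that(1)] by auto
  have "expected_cost line_dist s P \<sigma> \<le>
      real n + (\<Sum>i<length \<sigma>.
        (\<Sum>k\<in>{1..<n}. \<bar>partial_mass (p (take (Suc i) \<sigma>)) k - partial_mass (p (take i \<sigma>)) k\<bar>)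
        + (\<Sum>j\<in>{1..n}. p (take (Suc i) \<sigma>) j * (\<sigma> ! i) j))"
    if \<sigma>: "\<sigma> \<in> lists (tasks {1..n})" for \<sigma>
  proof -
    define F where "F i = partial_mass (p (take i \<sigma>))" for i
    define f where "f A = schedule_cost line_dist s \<sigma> (online_schedule A \<sigma>)" for A
    \<comment> \<open>A pointwise bound on the cost at level \<open>x\<close>, made of interval
      indicators so that its integral is explicit.\<close>
    define B where "B x = real n * indicator {0<..1} x + (\<Sum>i<length \<sigma>.
        (\<Sum>k\<in>{1..<n}. indicator {min (F (Suc i) k) (F i k)<..max (F (Suc i) k) (F i k)} x)
        + (\<Sum>j\<in>{1..n}. (\<sigma> ! i) j * indicator {F (Suc i) (j - 1)<..F (Suc i) j} x))" for x
    have tk: "take i \<sigma> \<in> lists (tasks {1..n})" for i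
      using \<sigma> by (auto dest: in_set_takeD)
    have F: "mono (F i)" "F i 0 = 0" "F i n = 1" for i
      using mono cdf0 cdfn tk by (auto simp: F_def)
    have Fr: "0 \<le> F i k" "F i k \<le> 1" if "k \<le> n" for i k
      using cdf_range[OF tk that] by (auto simp: F_def)
    have \<sigma>pos: "0 \<le> (\<sigma> ! i) j" if "i < length \<sigma>" "j \<in> {1..n}" for i j
    proof -
      have "\<sigma> ! i \<in> tasks {1..n}" using \<sigma> that(1) by auto
      then show ?thesis using that(2) by (auto simp: tasks_def PiE_iff)
    qed
    have intf: "integrable P f"
      unfolding f_def by (rule integrable_schedule_cost[OF _ s alg \<sigma>]) simp
    then have fM: "f \<in> borel_measurable M"
      using borel_measurable_integrable[OF intf] by (simp add: P_def)
    have intR: "integrable unif (\<lambda>x. f (R x))"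
      using intf by (simp add: P_def integrable_distr_eq[OF R fM])
    have "has_bochner_integral unif B (real n * (1 - 0) + (\<Sum>i<length \<sigma>.
        (\<Sum>k\<in>{1..<n}. max (F (Suc i) k) (F i k) - min (F (Suc i) k) (F i k))
        + (\<Sum>j\<in>{1..n}. (\<sigma> ! i) j * (F (Suc i) j - F (Suc i) (j - 1)))))"
      unfolding B_def
      by (intro has_bochner_integral_add has_bochner_integral_sum has_bochner_integral_mult_right
          has_bochner_integral_unif) (auto simp: Fr min_def max_def intro!: monoD[OF F(1)])
    also have "(\<Sum>i<length \<sigma>.
        (\<Sum>k\<in>{1..<n}. max (F (Suc i) k) (F i k) - min (F (Suc i) k) (F i k))
        + (\<Sum>j\<in>{1..n}. (\<sigma> ! i) j * (F (Suc i) j - F (Suc i) (j - 1)))) =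
      (\<Sum>i<length \<sigma>. (\<Sum>k\<in>{1..<n}. \<bar>F (Suc i) k - F i k\<bar>)
        + (\<Sum>j\<in>{1..n}. p (take (Suc i) \<sigma>) j * (\<sigma> ! i) j))"
    proof (intro sum.cong refl arg_cong2[where f = "(+)"])
      fix i j assume "j \<in> {1..n}"
      then obtain j' where j': "j = Suc j'" by (cases j) auto
      show "(\<sigma> ! i) j * (F (Suc i) j - F (Suc i) (j - 1)) = p (take (Suc i) \<sigma>) j * (\<sigma> ! i) j"
        unfolding j' by (simp add: F_def partial_mass_def)
    qed auto
    finally have intB: "has_bochner_integral unif B (real n * (1 - 0) + (\<Sum>i<length \<sigma>.
        (\<Sum>k\<in>{1..<n}. \<bar>F (Suc i) k - F i k\<bar>)
        + (\<Sum>j\<in>{1..n}. p (take (Suc i) \<sigma>) j * (\<sigma> ! i) j)))" .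
    have fB: "f (R x) \<le> B x" if x: "x \<in> space unif" for x
    proof -
      define X where "X i = quant n (F i) x" for i
      have x01: "0 < x" "x \<le> 1" using x by (auto simp: space_unif)
      have Xr: "X i \<in> {1..n}" for i unfolding X_def by (rule quant_range[OF n])
      have os: "online_schedule (R x) \<sigma> ! i = X (Suc i)" if "i < length \<sigma>" for i
      proof -
        have "take (Suc i) \<sigma> \<in> histories {1..n}"
          using tk[of "Suc i"] that by (auto simp: histories_def)
        then show ?thesis using that
          by (simp add: online_schedule_def R_def Q_def X_def F_def del: take_Suc)
      qed
      \<comment> \<open>The first move starts from \<open>s\<close> and not from \<open>X 0\<close>,
        the quantile for the empty history; this costs at most \<open>real n\<close> more.\<close>
      have "f (R x) \<le> (\<Sum>i<length \<sigma>. (if i = 0 then real n else 0)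
          + ((\<Sum>k\<in>{1..<n}. indicator {min (F (Suc i) k) (F i k)<..max (F (Suc i) k) (F i k)} x)
          + (\<Sum>j\<in>{1..n}. (\<sigma> ! i) j * indicator {F (Suc i) (j - 1)<..F (Suc i) j} x)))"
        unfolding f_def schedule_cost_def
      proof (rule sum_mono)
        fix i assume "i \<in> {..<length \<sigma>}"
        then have i: "i < length \<sigma>" by simp
        have "line_dist ((s # online_schedule (R x) \<sigma>) ! i) (X (Suc i))
            \<le> (if i = 0 then real n else 0) + \<bar>real (X (Suc i)) - real (X i)\<bar>"
        proof (cases i)
          case 0
          then show ?thesis using s Xr[of 0] by (auto simp: line_dist_def)
        next
          case (Suc i')
          then show ?thesis using os[of i'] i by (simp add: line_dist_def)
        qed
        also have "\<bar>real (X (Suc i)) - real (X i)\<bar> \<le>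
            (\<Sum>k\<in>{1..<n}. indicator {min (F (Suc i) k) (F i k)<..max (F (Suc i) k) (F i k)} x)"
          unfolding X_def by (rule quant_diff_le)
        finally have "line_dist ((s # online_schedule (R x) \<sigma>) ! i) (X (Suc i)) \<le>
            (if i = 0 then real n else 0) +
            (\<Sum>k\<in>{1..<n}. indicator {min (F (Suc i) k) (F i k)<..max (F (Suc i) k) (F i k)} x)"
          by simp
        moreover have "(\<sigma> ! i) (X (Suc i)) \<le>
            (\<Sum>j\<in>{1..n}. (\<sigma> ! i) j * indicator {F (Suc i) (j - 1)<..F (Suc i) j} x)"
          unfolding X_def using F x01 \<sigma>pos[OF i] by (intro quant_hit_le)
        ultimately show "line_dist ((s # online_schedule (R x) \<sigma>) ! i) (online_schedule (R x) \<sigma> ! i)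
              + (\<sigma> ! i) (online_schedule (R x) \<sigma> ! i)
            \<le> (if i = 0 then real n else 0)
          + ((\<Sum>k\<in>{1..<n}. indicator {min (F (Suc i) k) (F i k)<..max (F (Suc i) k) (F i k)} x)
          + (\<Sum>j\<in>{1..n}. (\<sigma> ! i) j * indicator {F (Suc i) (j - 1)<..F (Suc i) j} x))"
          using os[OF i] by simp
      qed
      also have "\<dots> \<le> B x"
        using x01 by (simp add: B_def sum.distrib)
      finally show ?thesis .
    qed
    have "expected_cost line_dist s P \<sigma> = (\<integral>x. f (R x) \<partial>unif)"
      unfolding expected_cost_def f_def[symmetric] P_def by (rule integral_distr[OF R fM])
    also have "\<dots> \<le> (\<integral>x. B x \<partial>unif)"
      using intR intB fB by (intro integral_mono) (auto simp: has_bochner_integral_iff)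
    also have "\<dots> = real n * (1 - 0) + (\<Sum>i<length \<sigma>.
        (\<Sum>k\<in>{1..<n}. \<bar>F (Suc i) k - F i k\<bar>)
        + (\<Sum>j\<in>{1..n}. p (take (Suc i) \<sigma>) j * (\<sigma> ! i) j))"
      using intB by (simp add: has_bochner_integral_iff)
    finally show ?thesis by (simp add: F_def)
  qed
  with alg show ?thesis by blast
qed


section \<open>Averaging over the shifts\<close>

primrec init :: "nat \<Rightarrow> tree" where
  "init 0 = Leaf"
| "init (Suc k) = Node k 0 (init k) (init k)"

lemma valid_init: "valid k (init k)"
  by (induction k) (auto intro: valid.intros)

text \<open>Inverts the shift by \<open>s\<close>, moving leaves outside the shifted line to its nearest end;
  the truncated subtraction is harmless because of the \<open>max\<close>.\<close>

definition place :: "nat \<Rightarrow> nat \<Rightarrow> nat \<Rightarrow> nat" where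
  "place n s i = max 1 (min n (i - s))"

lemma place_range: "1 \<le> n \<Longrightarrow> place n s i \<in> {1..n}"
  by (auto simp: place_def)

lemma place_add: "y \<in> {1..n} \<Longrightarrow> place n s (y + s) = y"
  by (auto simp: place_def)

lemma place_le_iff: "1 \<le> k \<Longrightarrow> k < n \<Longrightarrow> place n s i \<le> k \<longleftrightarrow> i < k + s + 1"
  by (auto simp: place_def)

text \<open>Leaves outside the shifted line copy the costs of its nearest end, which is where
  \<open>average\<close> puts their mass.\<close>

definition run :: "nat \<Rightarrow> nat \<Rightarrow> nat \<Rightarrow> (nat \<Rightarrow> real) list \<Rightarrow> tree" where
  "run n k s h = foldl (\<lambda>T c. step T (\<lambda>i. c (place n s i))) (init k) h"

definition average :: "nat \<Rightarrow> nat \<Rightarrow> (nat \<Rightarrow> real) list \<Rightarrow> nat \<Rightarrow> real" where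
  "average n K h j =
     (\<Sum>s<2 ^ K. \<Sum>i<2 ^ Suc K. of_bool (place n s i = j) * prob (run n (Suc K) s h) i) / 2 ^ K"

lemma tasks_nonneg: "c \<in> tasks M \<Longrightarrow> j \<in> M \<Longrightarrow> 0 \<le> c j"
  by (auto simp: tasks_def)

lemma valid_foldl_step:
  assumes "valid k T" "1 \<le> n" "h \<in> lists (tasks {1..n})"
  shows "valid k (foldl (\<lambda>T c. step T (\<lambda>i. c (place n s i))) T h)"
  using assms(3,1)
proof (induction arbitrary: T rule: lists.induct)
  case (Cons c h)
  then have "valid k (step T (\<lambda>i. c (place n s i)))"
    using place_range[OF assms(2)] by (intro valid_step tasks_nonneg) auto
  with Cons show ?case by simp
qed simp

lemma valid_run_place: "1 \<le> n \<Longrightarrow> h \<in> lists (tasks {1..n}) \<Longrightarrow> valid k (run n k s h)"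
  unfolding run_def by (intro valid_foldl_step valid_init)

lemma average_nonneg:
  assumes "1 \<le> n" "h \<in> lists (tasks {1..n})"
  shows "0 \<le> average n K h j"
  unfolding average_def
  by (intro divide_nonneg_nonneg sum_nonneg mult_nonneg_nonneg prob_nonneg[OF valid_run_place[OF assms]]) auto

text \<open>\<open>average\<close> is the mean of the images of the tree distributions under
  \<open>place\<close>. The test functions used are the constant 1, the indicator of an initial
  segment, and a task.\<close>

lemma sum_average:
  assumes "1 \<le> n"
  shows "(\<Sum>j\<in>{1..n}. average n K h j * c j) =
    (\<Sum>s<2 ^ K. \<Sum>i<2 ^ Suc K. prob (run n (Suc K) s h) i * c (place n s i)) / 2 ^ K"
proof -
  have *: "(\<Sum>j\<in>{1..n}. of_bool (place n s i = j) * x * c j) = x * c (place n s i)" for s i and x :: real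
  proof -
    have "(\<Sum>j\<in>{1..n}. of_bool (place n s i = j) * x * c j)
        = (\<Sum>j\<in>{1..n}. if place n s i = j then x * c j else 0)"
      by (intro sum.cong) auto
    then show ?thesis using place_range[OF assms, of s i] by simp
  qed
  have "(\<Sum>j\<in>{1..n}. average n K h j * c j) =
      (\<Sum>j\<in>{1..n}. \<Sum>s<2 ^ K. \<Sum>i<2 ^ Suc K.
        of_bool (place n s i = j) * prob (run n (Suc K) s h) i * c j) / 2 ^ K"
    unfolding average_def sum_divide_distrib sum_distrib_right by simp
  also have "(\<Sum>j\<in>{1..n}. \<Sum>s<2 ^ K. \<Sum>i<2 ^ Suc K.
        of_bool (place n s i = j) * prob (run n (Suc K) s h) i * c j) =
      (\<Sum>s<2 ^ K. \<Sum>i<2 ^ Suc K. \<Sum>j\<in>{1..n}.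
        of_bool (place n s i = j) * prob (run n (Suc K) s h) i * c j)"
    by (rule trans[OF sum.swap], rule sum.cong[OF refl], rule sum.swap)
  finally show ?thesis unfolding * .
qed

lemma sum_average_1:
  assumes "1 \<le> n" "h \<in> lists (tasks {1..n})"
  shows "(\<Sum>j\<in>{1..n}. average n K h j) = 1"
  using sum_average[OF assms(1), of K h "\<lambda>_. 1"] sum_prob[OF valid_run_place[OF assms, of "Suc K"]]
  by (simp del: power_Suc)

text \<open>\<open>place\<close> is monotone, so initial segments of the line pull back to initial
  segments of leaves; \<open>n \<le> 2 ^ K\<close> keeps the cut inside the tree.\<close>

lemma partial_mass_average:
  assumes "1 \<le> k" "k < n" "n \<le> 2 ^ K"
  shows "partial_mass (average n K h) k = (\<Sum>s<2 ^ K. cum (run n (Suc K) s h) (k + s + 1)) / 2 ^ K"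
proof -
  have "partial_mass (average n K h) k = (\<Sum>j\<in>{1..n}. average n K h j * of_bool (j \<le> k))"
    unfolding partial_mass_def using assms(2) by (intro sum.mono_neutral_cong_left) auto
  also have "\<dots> = (\<Sum>s<2 ^ K. \<Sum>i<2 ^ Suc K. prob (run n (Suc K) s h) i * of_bool (place n s i \<le> k)) / 2 ^ K"
    using assms by (intro sum_average) simp
  also have "(\<Sum>s<2 ^ K. \<Sum>i<2 ^ Suc K. prob (run n (Suc K) s h) i * of_bool (place n s i \<le> k))
      = (\<Sum>s<2 ^ K. cum (run n (Suc K) s h) (k + s + 1))"
  proof (intro sum.cong refl)
    fix s :: nat assume "s \<in> {..<2 ^ K}"
    then show "(\<Sum>i<2 ^ Suc K. prob (run n (Suc K) s h) i * of_bool (place n s i \<le> k)) =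
        cum (run n (Suc K) s h) (k + s + 1)"
      unfolding cum_def place_le_iff[OF assms(1,2)] using assms
      by (intro sum.mono_neutral_cong_right) auto
  qed
  finally show ?thesis .
qed

text \<open>By the triangle inequality over the shifts. For each shift the cuts
  \<open>k + s + 1\<close> are distinct positions below \<open>2 ^ Suc K\<close>, hence among those
  summed in \<open>move\<close>.\<close>

lemma sum_partial_mass_average_diff:
  assumes "n \<le> 2 ^ K"
  shows "(\<Sum>k\<in>{1..<n}. \<bar>partial_mass (average n K h') k - partial_mass (average n K h) k\<bar>)
    \<le> (\<Sum>s<2 ^ K. move (Suc K) (run n (Suc K) s h) (run n (Suc K) s h')) / 2 ^ K"
proof -
  define X where "X s m = \<bar>cum (run n (Suc K) s h') m - cum (run n (Suc K) s h) m\<bar>" for s m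
  have "(\<Sum>k\<in>{1..<n}. \<bar>partial_mass (average n K h') k - partial_mass (average n K h) k\<bar>)
      \<le> (\<Sum>k\<in>{1..<n}. (\<Sum>s<2 ^ K. X s (k + s + 1)) / 2 ^ K)"
  proof (rule sum_mono)
    fix k assume "k \<in> {1..<n}"
    then have "\<bar>partial_mass (average n K h') k - partial_mass (average n K h) k\<bar> =
       \<bar>\<Sum>s<2 ^ K. cum (run n (Suc K) s h') (k + s + 1) - cum (run n (Suc K) s h) (k + s + 1)\<bar> / 2 ^ K"
      using assms by (simp add: partial_mass_average sum_subtractf diff_divide_distrib[symmetric])
    also have "\<dots> \<le> (\<Sum>s<2 ^ K. X s (k + s + 1)) / 2 ^ K"
      unfolding X_def by (intro divide_right_mono sum_abs) simp
    finally show "\<bar>partial_mass (average n K h') k - partial_mass (average n K h) k\<bar> \<le> (\<Sum>s<2 ^ K. X s (k + s + 1)) / 2 ^ K" .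
  qed
  also have "\<dots> = (\<Sum>s<2 ^ K. \<Sum>k\<in>{1..<n}. X s (k + s + 1)) / 2 ^ K"
    unfolding sum_divide_distrib by (rule sum.swap)
  also have "\<dots> \<le> (\<Sum>s<2 ^ K. move (Suc K) (run n (Suc K) s h) (run n (Suc K) s h')) / 2 ^ K"
  proof (intro divide_right_mono sum_mono)
    fix s :: nat assume s: "s \<in> {..<2 ^ K}"
    have "(\<Sum>k\<in>{1..<n}. X s (k + s + 1)) = sum (X s) ((\<lambda>k. k + s + 1) ` {1..<n})"
      by (subst sum.reindex) (auto simp: inj_on_def)
    also have "\<dots> \<le> sum (X s) {..<2 ^ Suc K}"
      using s assms by (intro sum_mono2) (auto simp: X_def)
    finally show "(\<Sum>k\<in>{1..<n}. X s (k + s + 1)) \<le> move (Suc K) (run n (Suc K) s h) (run n (Suc K) s h')"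
      by (simp add: move_def X_def)
  qed simp
  finally show ?thesis .
qed

section \<open>Comparison with the optimum on the line\<close>

lemma opt_schedule:
  assumes "s \<in> M" "finite M"
  obtains y where "y 0 = s" "\<And>t. t \<le> length \<sigma> \<Longrightarrow> y t \<in> M"
    "opt_cost M d s \<sigma> = (\<Sum>t<length \<sigma>. d (y t) (y (Suc t)) + (\<sigma> ! t) (y (Suc t)))"
proof -
  let ?S = "{xs. set xs \<subseteq> M \<and> length xs = length \<sigma>}"
  have "finite ?S" using assms(2) by (rule finite_lists_length_eq)
  moreover have "replicate (length \<sigma>) s \<in> ?S" using assms(1) by auto
  ultimately have "opt_cost M d s \<sigma> \<in> schedule_cost d s \<sigma> ` ?S"
    unfolding opt_cost_def by (intro Min_in) auto
  then obtain xs where xs: "set xs \<subseteq> M" "length xs = length \<sigma>"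
    and opt: "opt_cost M d s \<sigma> = schedule_cost d s \<sigma> xs"
    by auto
  show ?thesis
  proof (rule that[of "\<lambda>t. (s # xs) ! t"])
    show "(s # xs) ! t \<in> M" if "t \<le> length \<sigma>" for t
      using xs assms(1) that by (cases t) (auto simp: subset_iff)
  qed (simp_all add: opt schedule_cost_def)
qed

lemma average_cost:
  assumes n: "1 \<le> n" "n \<le> 2 ^ K" and s0: "s0 \<in> {1..n}" and \<sigma>: "\<sigma> \<in> lists (tasks {1..n})"
  shows "(\<Sum>i<length \<sigma>.
        (\<Sum>k\<in>{1..<n}. \<bar>partial_mass (average n K (take (Suc i) \<sigma>)) k - partial_mass (average n K (take i \<sigma>)) k\<bar>)
        + (\<Sum>j\<in>{1..n}. average n K (take (Suc i) \<sigma>) j * (\<sigma> ! i) j))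
    \<le> (3 * real (Suc K) + 1) * real (Suc K) * opt_cost {1..n} line_dist s0 \<sigma>
      + (3 * real (Suc K) + 2) * 2 ^ Suc K"
proof -
  define H where "H = Suc K"
  define A where "A = 3 * real H + 1"
  define T where "T s t = run n H s (take t \<sigma>)" for s t
  define c where "c s t i = (\<sigma> ! t) (place n s i)" for s t i
  obtain y where y: "\<And>t. t \<le> length \<sigma> \<Longrightarrow> y t \<in> {1..n}"
    and opt: "opt_cost {1..n} line_dist s0 \<sigma> =
      (\<Sum>t<length \<sigma>. line_dist (y t) (y (Suc t)) + (\<sigma> ! t) (y (Suc t)))"
    using opt_schedule[OF s0] by blast
  have cpos: "0 \<le> (\<sigma> ! t) j" if "t < length \<sigma>" "j \<in> {1..n}" for t j
    using \<sigma> that by (intro tasks_nonneg[of _ "{1..n}"]) auto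
  have per_shift: "(\<Sum>t<length \<sigma>. move H (T s t) (T s (Suc t)) + (\<Sum>i<2 ^ H. prob (T s (Suc t)) i * c s t i))
      \<le> A * (2 ^ H + (\<Sum>t<length \<sigma>. tree_dist H (y t + s) (y (Suc t) + s) + (\<sigma> ! t) (y (Suc t)))) + 2 ^ H"
    if s: "s < 2 ^ K" for s
  proof -
    have T0: "valid H (T s 0)" by (simp add: T_def run_def valid_init)
    have TS: "T s (Suc t) = step (T s t) (c s t)" if "t < length \<sigma>" for t
      using that by (simp add: T_def run_def c_def[abs_def] take_Suc_conv_app_nth)
    have c: "0 \<le> c s t i" if "t < length \<sigma>" for t i
      unfolding c_def using that place_range[OF n(1)] by (intro cpos) auto
    \<comment> \<open>The optimal player is put on leaf \<open>y t + s\<close>, which exists since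
      \<open>y t \<le> 2 ^ K\<close> and \<open>s < 2 ^ K\<close>.\<close>
    have "(\<Sum>t<length \<sigma>. gain (T s t) (c s t)) \<le>
        2 ^ H + (\<Sum>t<length \<sigma>. tree_dist H (y t + s) (y (Suc t) + s) + c s t (y (Suc t) + s))"
    proof (rule gain_le_schedule[OF T0 TS c])
      fix t assume "t \<le> length \<sigma>"
      then show "y t + s < 2 ^ H" using y[of t] s n by (simp add: H_def)
    qed
    also have "\<dots> = 2 ^ H + (\<Sum>t<length \<sigma>. tree_dist H (y t + s) (y (Suc t) + s) + (\<sigma> ! t) (y (Suc t)))"
      using y by (simp add: c_def place_add)
    finally have gain: "A * (\<Sum>t<length \<sigma>. gain (T s t) (c s t)) \<le>
        A * (2 ^ H + (\<Sum>t<length \<sigma>. tree_dist H (y t + s) (y (Suc t) + s) + (\<sigma> ! t) (y (Suc t))))"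
      by (intro mult_left_mono) (auto simp: A_def)
    have "(\<Sum>t<length \<sigma>. move H (T s t) (T s (Suc t)) + (\<Sum>i<2 ^ H. prob (T s (Suc t)) i * c s t i))
        \<le> A * (\<Sum>t<length \<sigma>. gain (T s t) (c s t)) + 2 ^ H"
      unfolding A_def by (rule run_cost_le_gain[OF T0 TS c])
    with gain show ?thesis by linarith
  qed
  have "(\<Sum>i<length \<sigma>.
        (\<Sum>k\<in>{1..<n}. \<bar>partial_mass (average n K (take (Suc i) \<sigma>)) k - partial_mass (average n K (take i \<sigma>)) k\<bar>)
        + (\<Sum>j\<in>{1..n}. average n K (take (Suc i) \<sigma>) j * (\<sigma> ! i) j))
    \<le> (\<Sum>t<length \<sigma>. (\<Sum>s<2 ^ K. move H (T s t) (T s (Suc t))) / 2 ^ K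
        + (\<Sum>s<2 ^ K. \<Sum>i<2 ^ H. prob (T s (Suc t)) i * c s t i) / 2 ^ K)"
    unfolding sum_average[OF n(1)] c_def T_def H_def
    by (intro sum_mono add_mono sum_partial_mass_average_diff n order.refl)
  also have "\<dots> = (\<Sum>s<2 ^ K. \<Sum>t<length \<sigma>.
      move H (T s t) (T s (Suc t)) + (\<Sum>i<2 ^ H. prob (T s (Suc t)) i * c s t i)) / 2 ^ K"
    by (subst (2) sum.swap) (simp add: add_divide_distrib sum.distrib sum_divide_distrib)
  also have "\<dots> \<le> (\<Sum>s<2 ^ K. A * (2 ^ H + (\<Sum>t<length \<sigma>.
      tree_dist H (y t + s) (y (Suc t) + s) + (\<sigma> ! t) (y (Suc t)))) + 2 ^ H) / 2 ^ K"
    by (intro divide_right_mono sum_mono per_shift) auto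
  also have "\<dots> = (A + 1) * 2 ^ H + A * ((\<Sum>s<2 ^ K. \<Sum>t<length \<sigma>.
      tree_dist H (y t + s) (y (Suc t) + s) + (\<sigma> ! t) (y (Suc t))) / 2 ^ K)"
    by (simp add: sum.distrib sum_distrib_left[symmetric] field_simps)
  also have "(\<Sum>s<2 ^ K. \<Sum>t<length \<sigma>. tree_dist H (y t + s) (y (Suc t) + s) + (\<sigma> ! t) (y (Suc t)))
      = (\<Sum>t<length \<sigma>. (\<Sum>s<2 ^ K. tree_dist H (y t + s) (y (Suc t) + s)) + 2 ^ K * (\<sigma> ! t) (y (Suc t)))"
    by (subst sum.swap) (simp add: sum.distrib)
  \<comment> \<open>The shifts cost a factor \<open>H\<close> on distances. Service costs are
    inflated by the same factor, at least 1, so that the optimum can be factored out.\<close>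
  also have "(A + 1) * 2 ^ H + A * (\<dots> / 2 ^ K)
      \<le> (A + 1) * 2 ^ H + A * ((\<Sum>t<length \<sigma>. 2 ^ K * (real H * line_dist (y t) (y (Suc t)))
          + 2 ^ K * (real H * (\<sigma> ! t) (y (Suc t)))) / 2 ^ K)"
  proof (intro add_left_mono mult_left_mono divide_right_mono sum_mono add_mono)
    fix t assume "t \<in> {..<length \<sigma>}"
    then have "0 \<le> (\<sigma> ! t) (y (Suc t))" using y by (intro cpos) auto
    then show "(\<sigma> ! t) (y (Suc t)) \<le> real H * (\<sigma> ! t) (y (Suc t))"
      by (simp add: H_def mult_le_cancel_right1)
  qed (auto simp: A_def H_def sum_tree_dist_le simp del: of_nat_Suc)
  also have "(\<Sum>t<length \<sigma>. 2 ^ K * (real H * line_dist (y t) (y (Suc t)))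
          + 2 ^ K * (real H * (\<sigma> ! t) (y (Suc t)))) = 2 ^ K * (real H * opt_cost {1..n} line_dist s0 \<sigma>)"
    unfolding opt by (simp add: sum.distrib sum_distrib_left distrib_left)
  also have "(A + 1) * 2 ^ H + A * (2 ^ K * (real H * opt_cost {1..n} line_dist s0 \<sigma>) / 2 ^ K)
      = A * real H * opt_cost {1..n} line_dist s0 \<sigma> + (A + 1) * 2 ^ H"
    by simp
  also have "A + 1 = 3 * real H + 2" by (simp add: A_def)
  finally show ?thesis by (simp only: A_def H_def)
qed

theorem theorem5p6:
  "\<exists>C::real. \<forall>n::nat. n \<ge> 2 \<longrightarrow>
     (\<forall>s\<in>{1..n}. \<exists>P. randomized_algorithm {1..n} P \<and>
        competitive {1..n} line_dist s P (C * (ln (real n))\<^sup>2))"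
proof (intro exI[of _ "36 / (ln 2)\<^sup>2"] allI impI ballI)
  fix n s :: nat
  assume n: "2 \<le> n" and s: "s \<in> {1..n}"
  define K where "K = nat \<lceil>log 2 (real n)\<rceil>"
  have log1: "1 \<le> log 2 (real n)" using n by (simp add: le_log_iff)
  then have K: "log 2 (real n) \<le> real K" "real K \<le> log 2 (real n) + 1"
    by (auto simp: K_def)
  have "real n = 2 powr log 2 (real n)" using n by simp
  also have "\<dots> \<le> 2 powr real K" using K(1) by simp
  also have "\<dots> = real (2 ^ K)" by (simp add: powr_realpow)
  finally have nK: "n \<le> 2 ^ K" by simp
  have n1: "1 \<le> n" using n by simp
  obtain P where P: "randomized_algorithm {1..n} P"
    and cost: "\<And>\<sigma>. \<sigma> \<in> lists (tasks {1..n}) \<Longrightarrow> expected_cost line_dist s P \<sigma> \<le>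
      real n + (\<Sum>i<length \<sigma>.
        (\<Sum>k\<in>{1..<n}. \<bar>partial_mass (average n K (take (Suc i) \<sigma>)) k - partial_mass (average n K (take i \<sigma>)) k\<bar>)
        + (\<Sum>j\<in>{1..n}. average n K (take (Suc i) \<sigma>) j * (\<sigma> ! i) j))"
    using quantile_rounding[where p = "average n K", OF s average_nonneg[OF n1] sum_average_1[OF n1]] by blast
  have "competitive {1..n} line_dist s P (36 / (ln 2)\<^sup>2 * (ln (real n))\<^sup>2)"
    unfolding competitive_def
  proof (intro exI ballI)
    fix \<sigma> assume \<sigma>: "\<sigma> \<in> lists (tasks {1..n})"
    have opt_nonneg: "0 \<le> opt_cost {1..n} line_dist s \<sigma>"
    proof -
      obtain y where y: "\<And>t. t \<le> length \<sigma> \<Longrightarrow> y t \<in> {1..n}"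
        and "opt_cost {1..n} line_dist s \<sigma> =
          (\<Sum>t<length \<sigma>. line_dist (y t) (y (Suc t)) + (\<sigma> ! t) (y (Suc t)))"
        using opt_schedule[OF s] by blast
      moreover have "0 \<le> (\<sigma> ! t) (y (Suc t))" if "t < length \<sigma>" for t
        using \<sigma> that y[of "Suc t"] by (intro tasks_nonneg[of _ "{1..n}"]) auto
      ultimately show ?thesis by (auto simp: line_dist_def intro!: sum_nonneg)
    qed
    \<comment> \<open>Since \<open>1 \<le> log 2 (real n)\<close>, the bound
      \<open>log 2 (real n) + 2\<close> on \<open>Suc K\<close> is at most three logarithms. With
      \<open>3 * h + 1 \<le> 4 * h\<close> for \<open>1 \<le> h\<close> the constant is
      \<open>4 * 9 = 36\<close>, over the square of \<open>ln 2\<close>.\<close>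
    have H: "1 \<le> real (Suc K)" "real (Suc K) \<le> 3 * log 2 (real n)"
      using K log1 by auto
    have "(3 * real (Suc K) + 1) * real (Suc K) \<le> 4 * (real (Suc K))\<^sup>2"
      using H(1) by (simp add: power2_eq_square algebra_simps del: of_nat_Suc)
    also have "\<dots> \<le> 4 * (3 * log 2 (real n))\<^sup>2"
      using H by (intro mult_left_mono power_mono) auto
    also have "\<dots> = 36 / (ln 2)\<^sup>2 * (ln (real n))\<^sup>2"
      by (simp add: log_def power_mult_distrib power_divide)
    finally have "(3 * real (Suc K) + 1) * real (Suc K) * opt_cost {1..n} line_dist s \<sigma>
        \<le> 36 / (ln 2)\<^sup>2 * (ln (real n))\<^sup>2 * opt_cost {1..n} line_dist s \<sigma>"
      using opt_nonneg by (rule mult_right_mono)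
    with cost[OF \<sigma>] average_cost[OF n1 nK s \<sigma>]
    show "expected_cost line_dist s P \<sigma> \<le> 36 / (ln 2)\<^sup>2 * (ln (real n))\<^sup>2 * opt_cost {1..n} line_dist s \<sigma>
        + (real n + (3 * real (Suc K) + 2) * 2 ^ Suc K)"
      by linarith
  qed
  with P show "\<exists>P. randomized_algorithm {1..n} P \<and>
      competitive {1..n} line_dist s P (36 / (ln 2)\<^sup>2 * (ln (real n))\<^sup>2)"
    by blast
qed

end
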